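(* Let $1\le s\le d$ be integers, $a,\sigma>0$, $0<\delta<1$, $0<\alpha<1$. For any $0<\alpha'<\alpha$, provided $$\frac a\sigma\ge\kappa^*:=\Phi^{-1}(\delta)-\Phi^{-1}(\alpha'/s),$$ we have $$\sup_{\theta\in\Theta^+(s,a),\ \theta_j=0}\mathbb P_\theta(j\in\hat S_{\alpha'})\le1-\delta\quad(j\in[d])\qquad\text{and}\qquad\sup_{\theta\in\Theta^+(s,a)}\mathbb P_\theta(\theta\notin\hat M_{\alpha'})\le\alpha.$$ Here $$\hat S_{\alpha'}=\Big\{j\in[d]:\ \frac{X_j}\sigma\ge\Big(\Phi^{-1}\big(\tfrac{\alpha'}{s}\big)+\frac a\sigma\Big)\vee\Phi^{-1}(\delta)\Big\},$$ $\hat M_{\alpha'}=M(\hat S_{\alpha'},\hat U,\hat L)$ with $\hat L_j=(X_j-\hat u_{\alpha'}\sigma)_+$ and $\hat U_j=+\infty$ for $j\in\hat S_{\alpha'}$, and $$\hat u_{\alpha'}=\begin{cases}\Phi^{-1}\Big(1-\dfrac{\alpha-\alpha'}{d}\Big)&\text{if }\kappa^*\le a/\sigma<\kappa^*\vee\hat\kappa,\\[2mm]\Phi^{-1}\Big(1-\dfrac{\alpha-\alpha'-(d-s)(1-\eta^+)}{s}\Big)&\text{if }a/\sigma\ge\kappa^*\vee\hat\kappa,\end{cases}$$ where $\hat\kappa=-\Phi^{-1}\big(\frac{\alpha-\alpha'}{d}\big)-\Phi^{-1}\big(\frac{\alpha'}{s}\big)$ and $\eta^+=\Phi\big(\frac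 a\sigma+\Phi^{-1}(\frac{\alpha'}s)\big)$.
   Context: $X=(X_1,\dots,X_d)\sim N(\theta,\sigma^2 I_d)$ with $\theta\in\mathbb R^d$ unknown and $\sigma>0$ known; $\mathbb P_\theta$ is the corresponding probability. $\Phi$ is the standard normal c.d.f., $x\vee y=\max(x,y)$, $(x)_+=\max(x,0)$, $[d]=\{1,\dots,d\}$, $\|\theta\|_0=|\{j:\theta_j\neq0\}|$. The parameter space is $$\Theta^+(s,a)=\{\theta\in\mathbb R^d:\ \|\theta\|_0\le s,\ \min_{j:\theta_j\neq0}\theta_j\ge a\}.$$ For a random subset $S=S(X)\subseteq[d]$ and confidence bounds $L_j=L_j(X)$, $U_j=U_j(X)$, $$M(S,U,L)=\{\theta\in\mathbb R^d:\ \theta_j=0\text{ for all }j\in S^c,\ \theta_j\in[L_j,U_j]\text{ for all }j\in S\},$$ where $[L_j,+\infty]$ is understood as $[L_j,+\infty)$. *)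

theory Defs
  imports "HOL-Probability.Probability"
begin

text \<open>
  The coordinate set is a finite type \<open>'n\<close>: \<open>[d]\<close> is \<open>UNIV :: 'n set\<close>, \<open>d\<close> is \<open>CARD('n)\<close>, and
  the sample space is \<open>real ^ 'n\<close>.
\<close>

section \<open>Normal distributions\<close>

text \<open>
  The law \<open>N(\<theta>, \<sigma>\<^sup>2 I)\<close>: since the covariance is diagonal, the joint Lebesgue density is the product
  of the one-dimensional normal densities with means \<open>\<theta>\<^sub>j\<close>.  The second parameter of
  \<open>normal_density\<close> is the standard deviation, not the variance.
\<close>

definition iso_normal :: "real ^ 'n \<Rightarrow> real \<Rightarrow> (real ^ 'n) measure" where
  "iso_normal \<theta> \<sigma> = density lborel (\<lambda>x. \<Prod>j\<in>UNIV. normal_density (\<theta> $ j) \<sigma> (x $ j))"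

definition std_normal_cdf :: "real \<Rightarrow> real" where
  "std_normal_cdf = cdf std_normal_distribution"

text \<open>The inverse function of the normal c.d.f.; only its values on the range \<open>]0, 1[\<close> are meaningful.\<close>

definition std_normal_quantile :: "real \<Rightarrow> real" where
  "std_normal_quantile = inv std_normal_cdf"

section \<open>Parameter space and set estimators\<close>

definition l0_norm :: "real ^ 'n \<Rightarrow> nat" where
  "l0_norm \<theta> = card {j. \<theta> $ j \<noteq> 0}"

text \<open>The condition on the minimum over the support is void for \<open>\<theta> = 0\<close>, so \<open>0\<close> belongs to the space.\<close>

definition Theta_plus :: "nat \<Rightarrow> real \<Rightarrow> (real ^ 'n) set" where
  "Theta_plus s a = {\<theta>. l0_norm \<theta> \<le> s \<and> (\<forall>j. \<theta> $ j \<noteq> 0 \<longrightarrow> \<theta> $ j \<ge> a)}"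

text \<open>
  The bounds are extended reals and \<open>\<theta>\<close> has real coordinates, so an upper bound \<open>\<infinity>\<close> yields the
  half-line \<open>[L\<^sub>j, \<infinity>[\<close>.
\<close>

definition conf_set :: "'n set \<Rightarrow> ('n \<Rightarrow> ereal) \<Rightarrow> ('n \<Rightarrow> ereal) \<Rightarrow> (real ^ 'n) set" where
  "conf_set S U L = {\<theta>. (\<forall>j\<in>-S. \<theta> $ j = 0) \<and> (\<forall>j\<in>S. ereal (\<theta> $ j) \<in> {L j..U j})}"

section \<open>The procedure\<close>

definition kappa_star :: "nat \<Rightarrow> real \<Rightarrow> real \<Rightarrow> real" where
  "kappa_star s \<delta> \<alpha>' = std_normal_quantile \<delta> - std_normal_quantile (\<alpha>' / s)"

definition kappa_hat :: "nat \<Rightarrow> nat \<Rightarrow> real \<Rightarrow> real \<Rightarrow> real" where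
  "kappa_hat d s \<alpha> \<alpha>' = - std_normal_quantile ((\<alpha> - \<alpha>') / d) - std_normal_quantile (\<alpha>' / s)"

definition eta_plus :: "nat \<Rightarrow> real \<Rightarrow> real \<Rightarrow> real \<Rightarrow> real" where
  "eta_plus s a \<sigma> \<alpha>' = std_normal_cdf (a / \<sigma> + std_normal_quantile (\<alpha>' / s))"

definition S_hat :: "nat \<Rightarrow> real \<Rightarrow> real \<Rightarrow> real \<Rightarrow> real \<Rightarrow> real ^ 'n \<Rightarrow> 'n set" where
  "S_hat s a \<sigma> \<delta> \<alpha>' x =
     {j. x $ j / \<sigma> \<ge> max (std_normal_quantile (\<alpha>' / s) + a / \<sigma>) (std_normal_quantile \<delta>)}"

text \<open>
  The procedure is used only when \<open>kappa_star s \<delta> \<alpha>' \<le> a / \<sigma>\<close>, so the first branch is the regime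
  where \<open>a / \<sigma>\<close> lies in \<open>[\<kappa>*, max \<kappa>* \<kappa>hat[\<close>.
\<close>

definition u_hat :: "nat \<Rightarrow> nat \<Rightarrow> real \<Rightarrow> real \<Rightarrow> real \<Rightarrow> real \<Rightarrow> real \<Rightarrow> real" where
  "u_hat d s a \<sigma> \<delta> \<alpha> \<alpha>' =
     (if a / \<sigma> < max (kappa_star s \<delta> \<alpha>') (kappa_hat d s \<alpha> \<alpha>')
      then std_normal_quantile (1 - (\<alpha> - \<alpha>') / d)
      else std_normal_quantile
             (1 - (\<alpha> - \<alpha>' - (real d - real s) * (1 - eta_plus s a \<sigma> \<alpha>')) / s))"

definition L_hat ::
  "nat \<Rightarrow> real \<Rightarrow> real \<Rightarrow> real \<Rightarrow> real \<Rightarrow> real \<Rightarrow> real ^ 'n \<Rightarrow> 'n \<Rightarrow> ereal" where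
  "L_hat s a \<sigma> \<delta> \<alpha> \<alpha>' x j = ereal (max (x $ j - u_hat CARD('n) s a \<sigma> \<delta> \<alpha> \<alpha>' * \<sigma>) 0)"

definition M_hat ::
  "nat \<Rightarrow> real \<Rightarrow> real \<Rightarrow> real \<Rightarrow> real \<Rightarrow> real \<Rightarrow> real ^ 'n \<Rightarrow> (real ^ 'n) set" where
  "M_hat s a \<sigma> \<delta> \<alpha> \<alpha>' x =
     conf_set (S_hat s a \<sigma> \<delta> \<alpha>' x) (\<lambda>j. \<infinity>) (L_hat s a \<sigma> \<delta> \<alpha> \<alpha>' x)"

end

theory Submission
  imports Defs
begin

text \<open>
  A selected coordinate \<open>j\<close> with \<open>\<theta>\<^sub>j = 0\<close> has \<open>X\<^sub>j / \<sigma>\<close> standard normal and above \<open>\<Phi>\<inverse>(\<delta>)\<close>, which gives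
  the first bound.  For the second, write \<open>Z\<^sub>j = (X\<^sub>j - \<theta>\<^sub>j) / \<sigma>\<close>, \<open>q = \<Phi>\<inverse>(\<alpha>'/s)\<close> and \<open>u\<close> for the
  half-width.  Since \<open>a / \<sigma> \<ge> \<kappa>*\<close>, the selection threshold is \<open>q + a / \<sigma>\<close>, so missing a
  coordinate of the support forces \<open>Z\<^sub>j \<le> q\<close>.  A selected coordinate whose interval misses \<open>\<theta>\<^sub>j\<close> has
  \<open>Z\<^sub>j > u\<close>, and also \<open>Z\<^sub>j \<ge> q + a / \<sigma>\<close> when it lies outside the support.  The union bound charges the
  support \<open>\<alpha>'\<close> for the first kind of failure; for the second kind one may use \<open>Z\<^sub>j > u\<close> on any
  superset \<open>T\<close> of the support and \<open>Z\<^sub>j \<ge> q + a / \<sigma>\<close> off \<open>T\<close>.  The two definitions of \<open>u\<close> spend the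
  remaining \<open>\<alpha> - \<alpha>'\<close> with \<open>T = [d]\<close> and with \<open>|T| = s\<close> respectively.
\<close>

section \<open>The standard normal c.d.f.\<close>

lemma std_normal_measure_singleton: "measure std_normal_distribution {x} = 0"
proof -
  have "emeasure std_normal_distribution {x} = 0"
    by (subst emeasure_density)
      (auto simp: nn_integral_0_iff_AE intro: AE_mp[OF AE_lborel_singleton[of x]])
  then show ?thesis by (simp add: measure_def)
qed

text \<open>A c.d.f. is continuous exactly where its law has no atom. This feeds the intermediate
  value argument in \<open>std_normal_cdf_quantile\<close>.\<close>

lemma isCont_std_normal_cdf: "isCont std_normal_cdf x"
proof -
  interpret real_distribution std_normal_distribution by (rule real_dist_normal_dist)
  show ?thesis
    unfolding std_normal_cdf_def isCont_cdf by (rule std_normal_measure_singleton)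
qed

lemma mono_std_normal_cdf: "mono std_normal_cdf"
proof -
  interpret real_distribution std_normal_distribution by (rule real_dist_normal_dist)
  show ?thesis
    unfolding std_normal_cdf_def by (intro monoI cdf_nondecreasing)
qed

lemma std_normal_cdf_le_1: "std_normal_cdf x \<le> 1"
proof -
  interpret real_distribution std_normal_distribution by (rule real_dist_normal_dist)
  show ?thesis
    unfolding std_normal_cdf_def by (rule cdf_bounded_prob)
qed

text \<open>The two closed half-lines at \<open>x\<close> cover the line and overlap only in a null
  set.\<close>

lemma std_normal_measure_atLeast:
  "measure std_normal_distribution {x..} = 1 - std_normal_cdf x"
proof -
  interpret real_distribution std_normal_distribution by (rule real_dist_normal_dist)
  have "measure std_normal_distribution ({..x} \<union> {x..}) =
      measure std_normal_distribution {..x} + measure std_normal_distribution {x..}"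
    by (rule measure_Un_AE)
      (auto simp: AE_density fmeasurable_eq_sets intro: AE_mp[OF AE_lborel_singleton[of x]])
  moreover have "{..x} \<union> {x..} = space std_normal_distribution"
    by auto
  ultimately show ?thesis
    unfolding std_normal_cdf_def cdf_def2 using prob_space by simp
qed

text \<open>The density is even, so the substitution of \<open>- y\<close> for \<open>y\<close>
  carries the lower tail at \<open>- x\<close> to the upper tail at \<open>x\<close>.\<close>

lemma std_normal_cdf_minus: "std_normal_cdf (- x) = 1 - std_normal_cdf x"
proof -
  have "emeasure std_normal_distribution {..- x} =
      (\<integral>\<^sup>+y. ennreal (std_normal_density y) * indicator {..- x} y \<partial>lborel)"
    by (simp add: emeasure_density)
  also have "\<dots> = (\<integral>\<^sup>+y. ennreal (std_normal_density (- y)) * indicator {..- x} (- y) \<partial>lborel)"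
    by (subst nn_integral_real_affine[where c = "-1" and t = 0]) auto
  also have "\<dots> = (\<integral>\<^sup>+y. ennreal (std_normal_density y) * indicator {x..} y \<partial>lborel)"
    by (intro nn_integral_cong) (auto simp: std_normal_density_def split: split_indicator)
  also have "\<dots> = emeasure std_normal_distribution {x..}"
    by (simp add: emeasure_density)
  finally show ?thesis
    by (metis measure_def std_normal_cdf_def cdf_def2 std_normal_measure_atLeast)
qed

text \<open>As \<open>inv\<close> chooses a preimage, the claim amounts to \<open>p\<close> lying in
  the range, which follows from the limits 0 and 1 at the two ends and continuity.\<close>

lemma std_normal_cdf_quantile:
  assumes "0 < p" "p < 1"
  shows "std_normal_cdf (std_normal_quantile p) = p"
proof -
  interpret real_distribution std_normal_distribution by (rule real_dist_normal_dist)
  have "\<forall>\<^sub>F x in at_bot. std_normal_cdf x < p"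
    unfolding std_normal_cdf_def by (rule order_tendstoD(2)[OF cdf_lim_at_bot \<open>0 < p\<close>])
  then obtain l where l: "\<And>x. x \<le> l \<Longrightarrow> std_normal_cdf x < p"
    by (auto simp: eventually_at_bot_linorder)
  have "\<forall>\<^sub>F x in at_top. p < std_normal_cdf x"
    unfolding std_normal_cdf_def by (rule order_tendstoD(1)[OF cdf_lim_at_top_prob \<open>p < 1\<close>])
  then obtain r where r: "\<And>x. r \<le> x \<Longrightarrow> p < std_normal_cdf x"
    by (auto simp: eventually_at_top_linorder)
  \<comment> \<open>The right end is \<open>max l r\<close> because \<open>l \<le> r\<close> is not
    known.\<close>
  have "\<exists>x. l \<le> x \<and> x \<le> max l r \<and> std_normal_cdf x = p"
    by (rule IVT) (use l[of l] r[of "max l r"] isCont_std_normal_cdf in auto)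
  then show ?thesis
    unfolding std_normal_quantile_def by (intro f_inv_into_f) auto
qed

section \<open>Marginals of the isotropic normal distribution\<close>

lemma space_iso_normal [simp]: "space (iso_normal \<theta> \<sigma>) = UNIV"
  by (simp add: iso_normal_def)

lemma sets_iso_normal [simp, measurable_cong]: "sets (iso_normal \<theta> \<sigma>) = sets borel"
  by (simp add: iso_normal_def)

text \<open>Density and Lebesgue measure both factor over the coordinates, so the integral is a
  product in which every factor except the one for \<open>j\<close> is a total mass 1.\<close>

lemma emeasure_iso_normal_component:
  fixes \<theta> :: "real ^ 'n::finite"
  assumes "\<sigma> > 0" and [measurable]: "A \<in> sets borel"
  shows "emeasure (iso_normal \<theta> \<sigma>) {x. x $ j \<in> A} =
    emeasure (density lborel (normal_density (\<theta> $ j) \<sigma>)) A"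
proof -
  \<comment> \<open>The factors are indexed by basis vectors to fit
    \<open>nn_integral_lborel_prod\<close>; the constraint on coordinate \<open>j\<close> sits in
    the factor of \<open>axis j 1\<close>.\<close>
  define f where "f b x = ennreal (normal_density (\<theta> \<bullet> b) \<sigma> x) *
    (if b = axis j 1 then indicator A x else 1)" for b :: "real ^ 'n" and x
  have [measurable]: "f b \<in> borel_measurable borel" for b
    unfolding f_def by measurable
  have Basis: "(Basis :: (real ^ 'n) set) = range (\<lambda>i. axis i 1)"
    by (auto simp: Basis_vec_def)
  have inj: "inj (\<lambda>i. axis i 1 :: real ^ 'n)"
    by (auto simp: inj_def axis_eq_axis)
  have total: "(\<integral>\<^sup>+x. ennreal (normal_density \<mu> \<sigma> x) \<partial>lborel) = 1" for \<mu>
    using prob_space.emeasure_space_1[OF prob_space_normal_density[OF \<open>\<sigma> > 0\<close>], of \<mu>]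
    by (simp add: emeasure_density)
  have "(\<lambda>x :: real ^ 'n. \<Prod>i\<in>UNIV. normal_density (\<theta> $ i) \<sigma> (x $ i)) \<in> borel_measurable borel"
    by measurable
  then have "emeasure (iso_normal \<theta> \<sigma>) {x. x $ j \<in> A} =
      (\<integral>\<^sup>+x. ennreal (\<Prod>i\<in>UNIV. normal_density (\<theta> $ i) \<sigma> (x $ i)) *
        indicator {x. x $ j \<in> A} x \<partial>lborel)"
    unfolding iso_normal_def by (subst emeasure_density) auto
  also have "\<dots> = (\<integral>\<^sup>+x. (\<Prod>b\<in>Basis. f b (x \<bullet> b)) \<partial>lborel)"
  proof (intro nn_integral_cong)
    fix x :: "real ^ 'n"
    have "(\<Prod>b\<in>Basis. f b (x \<bullet> b)) = (\<Prod>i\<in>UNIV. f (axis i 1) (x $ i))"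
      unfolding Basis by (subst prod.reindex[OF inj]) (simp add: inner_axis)
    also have "\<dots> = (\<Prod>i\<in>UNIV. ennreal (normal_density (\<theta> $ i) \<sigma> (x $ i))) *
        (\<Prod>i\<in>UNIV. if i = j then indicator A (x $ i) else 1)"
      by (simp add: f_def inner_axis axis_eq_axis prod.distrib)
    also have "\<dots> = ennreal (\<Prod>i\<in>UNIV. normal_density (\<theta> $ i) \<sigma> (x $ i)) *
        indicator {x. x $ j \<in> A} x"
      by (simp add: prod_ennreal indicator_def)
    finally show "ennreal (\<Prod>i\<in>UNIV. normal_density (\<theta> $ i) \<sigma> (x $ i)) *
        indicator {x. x $ j \<in> A} x = (\<Prod>b\<in>Basis. f b (x \<bullet> b))" ..
  qed
  also have "\<dots> = (\<Prod>b\<in>Basis. \<integral>\<^sup>+x. f b x \<partial>lborel)"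
    by (rule nn_integral_lborel_prod) auto
  also have "\<dots> = (\<Prod>i\<in>UNIV. \<integral>\<^sup>+x. f (axis i 1) x \<partial>lborel)"
    unfolding Basis by (subst prod.reindex[OF inj]) simp
  also have "\<dots> = (\<Prod>i\<in>UNIV. if i = j
      then \<integral>\<^sup>+x. ennreal (normal_density (\<theta> $ j) \<sigma> x) * indicator A x \<partial>lborel else 1)"
    by (intro prod.cong) (auto simp: f_def inner_axis axis_eq_axis total)
  also have "\<dots> = emeasure (density lborel (normal_density (\<theta> $ j) \<sigma>)) A"
    by (simp add: emeasure_density)
  finally show ?thesis .
qed

text \<open>The total mass is that of any one marginal; \<open>undefined\<close> serves as an
  arbitrary coordinate.\<close>

lemma prob_space_iso_normal:
  fixes \<theta> :: "real ^ 'n::finite"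
  assumes "\<sigma> > 0"
  shows "prob_space (iso_normal \<theta> \<sigma>)"
  using emeasure_iso_normal_component[OF assms, of UNIV \<theta> undefined]
    prob_space.emeasure_space_1[OF prob_space_normal_density[OF assms]]
  by (intro prob_spaceI) simp

lemma distr_iso_normal_standardized:
  fixes \<theta> :: "real ^ 'n::finite"
  assumes "\<sigma> > 0"
  shows "distr (iso_normal \<theta> \<sigma>) lborel (\<lambda>x. (x $ j - \<theta> $ j) / \<sigma>) = std_normal_distribution"
proof -
  interpret prob_space "iso_normal \<theta> \<sigma>" by (rule prob_space_iso_normal[OF assms])
  have "distr (iso_normal \<theta> \<sigma>) lborel (\<lambda>x. x $ j) =
      density lborel (normal_density (\<theta> $ j) \<sigma>)"
  proof (rule measure_eqI)
    fix A assume "A \<in> sets (distr (iso_normal \<theta> \<sigma>) lborel (\<lambda>x. x $ j))"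
    then show "emeasure (distr (iso_normal \<theta> \<sigma>) lborel (\<lambda>x. x $ j)) A =
        emeasure (density lborel (normal_density (\<theta> $ j) \<sigma>)) A"
      using emeasure_iso_normal_component[OF assms, of A \<theta> j]
      by (subst emeasure_distr) (auto simp: vimage_def)
  qed simp
  then have "distributed (iso_normal \<theta> \<sigma>) lborel (\<lambda>x. x $ j) (normal_density (\<theta> $ j) \<sigma>)"
    by (simp add: distributed_def)
  then show ?thesis
    unfolding normal_standard_normal_convert[OF assms] by (rule distributed_distr_eq_density)
qed

lemma
  fixes \<theta> :: "real ^ 'n::finite"
  assumes "\<sigma> > 0"
  shows measure_iso_normal_lower_tail:
      "measure (iso_normal \<theta> \<sigma>) {x. (x $ j - \<theta> $ j) / \<sigma> \<le> c} = std_normal_cdf c" (is ?lower)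
    and measure_iso_normal_upper_tail:
      "measure (iso_normal \<theta> \<sigma>) {x. c \<le> (x $ j - \<theta> $ j) / \<sigma>} = 1 - std_normal_cdf c" (is ?upper)
proof -
  have *: "measure std_normal_distribution A =
      measure (iso_normal \<theta> \<sigma>) {x. (x $ j - \<theta> $ j) / \<sigma> \<in> A}" if "A \<in> sets borel" for A
    unfolding distr_iso_normal_standardized[OF assms, of \<theta> j, symmetric]
    using that by (subst measure_distr) (auto simp: vimage_def)
  show ?lower
    using *[of "{..c}"] by (simp add: std_normal_cdf_def cdf_def2)
  show ?upper
    using *[of "{c..}"] by (simp add: std_normal_measure_atLeast)
qed

section \<open>Union bound for the noncoverage probability\<close>

text \<open>The set \<open>T\<close> stays free so that one inequality serves both definitions of
  the half-width. The tail values at \<open>q\<close> and \<open>u\<close> are left unevaluated, so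
  the levels enter only in the theorem.\<close>

lemma prob_noncoverage_le:
  fixes \<theta> :: "real ^ 'n::finite" and T :: "'n set"
    and s :: nat and a \<sigma> \<delta> \<alpha> \<alpha>' :: real
  defines "q \<equiv> std_normal_quantile (\<alpha>' / s)"
    and "u \<equiv> u_hat CARD('n) s a \<sigma> \<delta> \<alpha> \<alpha>'"
  assumes \<theta>: "\<theta> \<in> Theta_plus s a" and pos: "a > 0" "\<sigma> > 0"
    and kappa: "kappa_star s \<delta> \<alpha>' \<le> a / \<sigma>"
    and T: "{j. \<theta> $ j \<noteq> 0} \<subseteq> T"
  shows "\<P>(x in iso_normal \<theta> \<sigma>. \<theta> \<notin> M_hat s a \<sigma> \<delta> \<alpha> \<alpha>' x) \<le>
    real s * std_normal_cdf q +
    real (card T) * (1 - std_normal_cdf u) +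
    real (card (- T)) * (1 - std_normal_cdf (a / \<sigma> + q))"
proof -
  let ?M = "iso_normal \<theta> \<sigma>"
  interpret prob_space ?M by (rule prob_space_iso_normal[OF pos(2)])
  define Z where "Z j x = (x $ j - \<theta> $ j) / \<sigma>" for j and x :: "real ^ 'n"
  define supp where "supp = {j. \<theta> $ j \<noteq> 0}"
  \<comment> \<open>\<open>A\<close> covers a missed signal, \<open>B\<close> a lower bound above
    the true value, \<open>C\<close> the selection of a null coordinate. All are closed tails, which
    only enlarges the strict events.\<close>
  define A where "A j = {x. Z j x \<le> q}" for j
  define B where "B j = {x. u \<le> Z j x}" for j
  define C where "C j = {x. a / \<sigma> + q \<le> Z j x}" for j
  have [measurable]: "Z j \<in> borel_measurable borel" for j
    unfolding Z_def by measurable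
  have sets: "A j \<in> sets ?M" "B j \<in> sets ?M" "C j \<in> sets ?M" for j
    unfolding A_def B_def C_def by measurable
  have prob: "prob (A j) = std_normal_cdf q" "prob (B j) = 1 - std_normal_cdf u"
    "prob (C j) = 1 - std_normal_cdf (a / \<sigma> + q)" for j
    unfolding A_def B_def C_def Z_def
    by (simp_all only: measure_iso_normal_lower_tail[OF pos(2)]
        measure_iso_normal_upper_tail[OF pos(2)])
  have in_S: "j \<in> S_hat s a \<sigma> \<delta> \<alpha>' x \<longleftrightarrow> a / \<sigma> + q \<le> x $ j / \<sigma>" for j and x :: "real ^ 'n"
    using kappa by (auto simp: S_hat_def kappa_star_def q_def)
  have in_M: "\<theta> \<in> M_hat s a \<sigma> \<delta> \<alpha> \<alpha>' x \<longleftrightarrow>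
      (\<forall>j\<in>- S_hat s a \<sigma> \<delta> \<alpha>' x. \<theta> $ j = 0) \<and>
      (\<forall>j\<in>S_hat s a \<sigma> \<delta> \<alpha>' x. max (x $ j - u * \<sigma>) 0 \<le> \<theta> $ j)" for x
    by (simp add: M_hat_def conf_set_def L_hat_def u_def)
  \<comment> \<open>Truncating the lower bound at 0 therefore never causes noncoverage.\<close>
  have nonneg: "0 \<le> \<theta> $ j" for j
    using \<theta> pos(1)
    by (cases "\<theta> $ j = 0") (auto simp: Theta_plus_def intro: order_trans[OF less_imp_le])
  have "{x \<in> space ?M. \<theta> \<notin> M_hat s a \<sigma> \<delta> \<alpha> \<alpha>' x} \<subseteq>
      (\<Union>j\<in>supp. A j) \<union> (\<Union>j\<in>T. B j) \<union> (\<Union>j\<in>-T. C j)"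
  proof
    fix x assume "x \<in> {x \<in> space ?M. \<theta> \<notin> M_hat s a \<sigma> \<delta> \<alpha> \<alpha>' x}"
    then consider j where "j \<notin> S_hat s a \<sigma> \<delta> \<alpha>' x" "\<theta> $ j \<noteq> 0"
      | j where "j \<in> S_hat s a \<sigma> \<delta> \<alpha>' x" "\<not> max (x $ j - u * \<sigma>) 0 \<le> \<theta> $ j"
      unfolding in_M by auto
    then show "x \<in> (\<Union>j\<in>supp. A j) \<union> (\<Union>j\<in>T. B j) \<union> (\<Union>j\<in>-T. C j)"
    proof cases
      case 1
      have "a / \<sigma> \<le> \<theta> $ j / \<sigma>"
        using 1(2) \<theta> pos by (intro divide_right_mono) (auto simp: Theta_plus_def)
      then have "Z j x \<le> q"
        using 1(1) unfolding in_S Z_def diff_divide_distrib by linarith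
      then show ?thesis
        using 1(2) by (auto simp: supp_def A_def)
    next
      case 2
      show ?thesis
      proof (cases "j \<in> T")
        case True
        have "u * \<sigma> \<le> x $ j - \<theta> $ j"
          using 2(2) nonneg[of j] by linarith
        then have "u \<le> Z j x"
          using pos by (simp add: Z_def pos_le_divide_eq)
        then show ?thesis
          using True by (auto simp: B_def)
      next
        case False
        then have "\<theta> $ j = 0"
          using T by auto
        then have "x \<in> C j"
          using 2(1) by (simp add: in_S C_def Z_def)
        then show ?thesis
          using False by blast
      qed
    qed
  qed
  then have "prob {x \<in> space ?M. \<theta> \<notin> M_hat s a \<sigma> \<delta> \<alpha> \<alpha>' x} \<le>
      prob ((\<Union>j\<in>supp. A j) \<union> (\<Union>j\<in>T. B j) \<union> (\<Union>j\<in>-T. C j))"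
    using sets by (intro finite_measure_mono) auto
  also have "\<dots> \<le> prob (\<Union>j\<in>supp. A j) + prob (\<Union>j\<in>T. B j) + prob (\<Union>j\<in>-T. C j)"
    using sets by (intro order_trans[OF measure_Un_le] add_mono order_refl) auto
  also have "\<dots> \<le> (\<Sum>j\<in>supp. prob (A j)) + (\<Sum>j\<in>T. prob (B j)) + (\<Sum>j\<in>-T. prob (C j))"
    using sets by (intro add_mono finite_measure_subadditive_finite) auto
  also have "\<dots> = real (card supp) * std_normal_cdf q + real (card T) * (1 - std_normal_cdf u) +
      real (card (- T)) * (1 - std_normal_cdf (a / \<sigma> + q))"
    by (simp add: prob)
  \<comment> \<open>\<open>\<Phi>(q) \<ge> 0\<close> is read off from the probability of
    \<open>A\<close> at an arbitrary index.\<close>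
  also have "real (card supp) * std_normal_cdf q \<le> real s * std_normal_cdf q"
    using \<theta> measure_nonneg[of ?M "A undefined", unfolded prob]
    by (intro mult_right_mono) (auto simp: Theta_plus_def l0_norm_def supp_def)
  finally show ?thesis by simp
qed

theorem theorem2p5:
  fixes s :: nat and a \<sigma> \<delta> \<alpha> \<alpha>' :: real
  assumes "1 \<le> s" and "s \<le> CARD('n::finite)"
    and "a > 0" and "\<sigma> > 0"
    and "0 < \<delta>" and "\<delta> < 1"
    and "0 < \<alpha>" and "\<alpha> < 1"
    and "0 < \<alpha>'" and "\<alpha>' < \<alpha>"
    and "a / \<sigma> \<ge> kappa_star s \<delta> \<alpha>'"
  shows "(\<forall>j::'n.
           (SUP \<theta> \<in> {\<theta> \<in> Theta_plus s a. \<theta> $ j = 0}.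
              \<P>(x in iso_normal \<theta> \<sigma>. j \<in> S_hat s a \<sigma> \<delta> \<alpha>' x)) \<le> 1 - \<delta>) \<and>
         (SUP \<theta> \<in> (Theta_plus s a :: (real ^ 'n) set).
            \<P>(x in iso_normal \<theta> \<sigma>. \<theta> \<notin> M_hat s a \<sigma> \<delta> \<alpha> \<alpha>' x)) \<le> \<alpha>"
proof (intro conjI allI cSUP_least)
  \<comment> \<open>The rule \<open>cSUP_least\<close> asks for nonempty index sets; the zero vector
    lies in both.\<close>
  have zero: "(0 :: real ^ 'n) \<in> Theta_plus s a"
    by (simp add: Theta_plus_def l0_norm_def)
  then show "(Theta_plus s a :: (real ^ 'n) set) \<noteq> {}"
    by blast
  show "{\<theta> \<in> Theta_plus s a. \<theta> $ j = 0} \<noteq> {}" for j :: 'n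
    using zero by force
next
  fix j :: 'n and \<theta> :: "real ^ 'n"
  assume "\<theta> \<in> {\<theta> \<in> Theta_plus s a. \<theta> $ j = 0}"
  then have \<theta>: "\<theta> $ j = 0"
    by simp
  interpret prob_space "iso_normal \<theta> \<sigma>" by (rule prob_space_iso_normal[OF \<open>\<sigma> > 0\<close>])
  let ?E = "{x. std_normal_quantile \<delta> \<le> (x $ j - \<theta> $ j) / \<sigma>}"
  have "prob {x \<in> space (iso_normal \<theta> \<sigma>). j \<in> S_hat s a \<sigma> \<delta> \<alpha>' x} \<le> prob ?E"
  proof (rule finite_measure_mono)
    show "?E \<in> events" by measurable
  qed (auto simp: S_hat_def \<theta>)
  also have "\<dots> = 1 - \<delta>"
    using assms by (simp only: measure_iso_normal_upper_tail std_normal_cdf_quantile)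
  finally show "\<P>(x in iso_normal \<theta> \<sigma>. j \<in> S_hat s a \<sigma> \<delta> \<alpha>' x) \<le> 1 - \<delta>" .
next
  fix \<theta> :: "real ^ 'n"
  assume \<theta>: "\<theta> \<in> Theta_plus s a"
  define d where "d = CARD('n)"
  define \<eta> where "\<eta> = eta_plus s a \<sigma> \<alpha>'"
  have s: "0 < real s" "real s \<le> real d" "0 < real d"
    using assms by (auto simp: d_def)
  have less_1: "p / real k < 1" if "p < 1" "0 < real k" for p k
    using that by (simp add: divide_less_eq)
  have q: "real s * std_normal_cdf (std_normal_quantile (\<alpha>' / s)) = \<alpha>'"
    using assms s less_1[of \<alpha>' s] by (subst std_normal_cdf_quantile) auto
  have p: "0 < (\<alpha> - \<alpha>') / d" "(\<alpha> - \<alpha>') / d < 1"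
    using assms s less_1[of "\<alpha> - \<alpha>'" d] by auto
  have bound: "\<P>(x in iso_normal \<theta> \<sigma>. \<theta> \<notin> M_hat s a \<sigma> \<delta> \<alpha> \<alpha>' x) \<le>
      \<alpha>' + real (card T) * (1 - std_normal_cdf (u_hat d s a \<sigma> \<delta> \<alpha> \<alpha>')) + real (card (- T)) * (1 - \<eta>)"
    if "{j. \<theta> $ j \<noteq> 0} \<subseteq> T" for T
    using prob_noncoverage_le[OF \<theta> assms(3,4,11) that, of \<alpha>]
    unfolding q d_def \<eta>_def eta_plus_def .
  show "\<P>(x in iso_normal \<theta> \<sigma>. \<theta> \<notin> M_hat s a \<sigma> \<delta> \<alpha> \<alpha>' x) \<le> \<alpha>"
  proof (cases "a / \<sigma> < max (kappa_star s \<delta> \<alpha>') (kappa_hat d s \<alpha> \<alpha>')")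
    case True
    \<comment> \<open>With \<open>T = UNIV\<close> the \<open>d\<close> coordinates share
      \<open>\<alpha> - \<alpha>'\<close> equally and the complement is empty.\<close>
    then have "1 - std_normal_cdf (u_hat d s a \<sigma> \<delta> \<alpha> \<alpha>') = (\<alpha> - \<alpha>') / d"
      using p by (simp add: u_hat_def std_normal_cdf_quantile)
    with bound[of UNIV] s show ?thesis
      by (simp add: d_def)
  next
    case False
    \<comment> \<open>The share of each coordinate of \<open>T\<close> once the \<open>d - s\<close>
      others have been charged \<open>1 - \<eta>\<close>. It must lie strictly between 0 and 1 for
      the quantile to invert the c.d.f.\<close>
    define \<beta> where "\<beta> = (\<alpha> - \<alpha>' - (real d - real s) * (1 - \<eta>)) / s"
    \<comment> \<open>The condition \<open>a / \<sigma> \<ge> kappa_hat\<close> rearranged: by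
      monotonicity and symmetry of the c.d.f., each coordinate off \<open>T\<close> costs at most
      \<open>(\<alpha> - \<alpha>') / d\<close>, which leaves a positive budget for
      \<open>T\<close>.\<close>
    have "- std_normal_quantile ((\<alpha> - \<alpha>') / d) \<le> a / \<sigma> + std_normal_quantile (\<alpha>' / s)"
      using False by (simp add: kappa_hat_def)
    then have "1 - (\<alpha> - \<alpha>') / d \<le> \<eta>"
      using monoD[OF mono_std_normal_cdf] p
      by (force simp: \<eta>_def eta_plus_def std_normal_cdf_minus std_normal_cdf_quantile)
    then have "(real d - real s) * (1 - \<eta>) \<le> (real d - real s) * ((\<alpha> - \<alpha>') / d)"
      using s by (intro mult_left_mono) auto
    then have "real s * ((\<alpha> - \<alpha>') / d) \<le> \<alpha> - \<alpha>' - (real d - real s) * (1 - \<eta>)"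
      using s by (simp add: field_simps)
    then have "0 < \<beta>"
      unfolding \<beta>_def using mult_pos_pos[OF s(1) p(1)] s(1) by (intro divide_pos_pos) linarith+
    have "0 \<le> (real d - real s) * (1 - \<eta>)"
      using s by (simp add: \<eta>_def eta_plus_def std_normal_cdf_le_1)
    then have "\<beta> < 1"
      unfolding \<beta>_def using assms s by (intro less_1) auto
    have u: "1 - std_normal_cdf (u_hat d s a \<sigma> \<delta> \<alpha> \<alpha>') = \<beta>"
      using False \<open>0 < \<beta>\<close> \<open>\<beta> < 1\<close>
      by (simp add: u_hat_def std_normal_cdf_quantile flip: \<eta>_def \<beta>_def)
    \<comment> \<open>The support may be smaller than \<open>s\<close>; padding it to size exactly
      \<open>s\<close> makes the charges \<open>s * \<beta>\<close> and
      \<open>(d - s) * (1 - \<eta>)\<close> add up to \<open>\<alpha> - \<alpha>'\<close>.\<close>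
    obtain T where T: "{j. \<theta> $ j \<noteq> 0} \<subseteq> T" "card T = s"
      using exists_subset_between[of "{j. \<theta> $ j \<noteq> 0}" s UNIV] \<theta> assms(2)
      by (auto simp: Theta_plus_def l0_norm_def)
    have "real (card (- T)) = real d - real s"
      using assms(2) T(2) by (simp add: Compl_eq_Diff_UNIV card_Diff_subset d_def of_nat_diff)
    with bound[OF T(1)] show ?thesis
      unfolding u T(2) using s by (simp add: \<beta>_def)
  qed
qed

end
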